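(* Let $\Xi=\{\xi\in\mathbb R_+^K:S\xi=t\}$ be a nonempty bounded polytope with $S\in\mathbb R^{J\times K}$, $t\in\mathbb R^J$, and suppose $\Xi\subseteq\{\xi\in\mathbb R^K:\|Q(\xi-q)\|\le \varrho\}$ for some symmetric positive definite $Q\in\mathbb R^{K\times K}$, $q\in\mathbb R_+^K$ and $\varrho>0$. Fix $x\in\mathcal X$ and let $Z(x)$, $\overline Z(x)$, $\overline Z^{\mathcal C_0}(x)$, $\overline Z^{\mathcal S}(x)$ be the optimal values defined in the context: respectively the worst-case quadratic objective, its copositive programming reformulation, the semidefinite approximation of the latter obtained by replacing $\mathcal C$ with $\mathcal C^0$, and the approximate $\mathcal S$-lemma bound. Then $$Z(x)=\overline Z(x)\le\overline Z^{\mathcal C_0}(x)\le\overline Z^{\mathcal S}(x).$$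
   Context: $\mathcal X\subseteq\mathbb R^D$ is a polytope; $A:\mathcal X\to\mathbb R^{M\times K}$ and $b:\mathcal X\to\mathbb R^K$ are affine; $c:\mathcal X\to\mathbb R$ is a convex quadratic function; $\|\cdot\|$ is the Euclidean norm, $\circ$ the entrywise product. Cones of symmetric matrices: $\mathcal C$ is the set of copositive matrices (symmetric $N$ with $z^\top Nz\ge0$ for all $z\ge0$); $\mathcal C^0$ is the set of matrices $N=N_1+N_2$ with $N_1$ symmetric positive semidefinite and $N_2$ symmetric entrywise nonnegative. $N\succeq_{\mathcal C}0$ means $N\in\mathcal C$; $N\succeq0$ means positive semidefinite. Definitions of the four values for fixed $x\in\mathcal X$ (infimum of an infeasible problem is $+\infty$): (1) $Z(x)=\sup_{\xi\in\Xi}\|A(x)\xi\|^2+b(x)^\top\xi+c(x)$. (2) $\overline Z(x)$ is the infimum of $c(x)+t^\top\psi+(t\circ t)^\top\phi+\lambda \varrho^2-\lambda\|Qq\|^2+\tau$ over $\tau\in\mathbb R$, $\lambda\in\mathbb R_+$, $\psi,\phi\in\mathbb R^J$ subject to $$\begin{bmatrix}\lambda Q^\top Q+S^\top\operatorname{diag}(\phi)S-A(x)^\top A(x)&\frac12\left(S^\top\psi-b(x)-2\lambda Q^\top Qq\right)\\ \frac12\left(S^\top\psi-b(x)-2\lambda Q^\top Qq\right)^\top&\tau\end{bmatrix}\succeq_{\mathcal C}0.$$ (3) $\overline Z^{\mathcal C_0}(x)$ is the optimal value of the problem in (2) with the constraint that the displayed matrix lies in $\mathcal C$ replaced by the constraint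 that it lies in $\mathcal C^0$. (4) $\overline Z^{\mathcal S}(x)$ is the infimum of $c(x)+t^\top\theta+\rho \varrho^2-\rho\|Qq\|^2+\kappa$ over $\kappa\in\mathbb R$, $\rho\in\mathbb R_+$, $\theta\in\mathbb R^J$, $\eta\in\mathbb R_+^K$ subject to $$\begin{bmatrix}\rho Q^\top Q-A(x)^\top A(x)&\frac12\left(S^\top\theta-b(x)-\eta-2\rho Q^\top Qq\right)\\ \frac12\left(S^\top\theta-b(x)-\eta-2\rho Q^\top Qq\right)^\top&\kappa\end{bmatrix}\succeq0.$$ *)

theory Defs
  imports "HOL-Analysis.Analysis"
begin

text \<open>
  A matrix with \<open>m\<close> rows and \<open>k\<close> columns has type \<open>real^'k^'m\<close>.  On vectors and matrices
  \<open>\<le>\<close> is the library's entrywise order, \<open>*\<close> on vectors is the library's entrywise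
  product, and \<open>norm\<close> on vectors is the Euclidean norm.
\<close>

definition sym_mat :: "real^'n^'n \<Rightarrow> bool" where
  "sym_mat N \<longleftrightarrow> transpose N = N"

definition psd_cone :: "(real^'n^'n) set" where
  "psd_cone = {N. sym_mat N \<and> (\<forall>z. 0 \<le> z \<bullet> (N *v z))}"

definition pos_def :: "real^'n^'n \<Rightarrow> bool" where
  "pos_def N \<longleftrightarrow> sym_mat N \<and> (\<forall>z. z \<noteq> 0 \<longrightarrow> 0 < z \<bullet> (N *v z))"

definition copositive_cone :: "(real^'n^'n) set" where
  "copositive_cone = {N. sym_mat N \<and> (\<forall>z\<ge>0. 0 \<le> z \<bullet> (N *v z))}"

definition C0_cone :: "(real^'n^'n) set" where
  "C0_cone = {N1 + N2 | N1 N2. N1 \<in> psd_cone \<and> sym_mat N2 \<and> 0 \<le> N2}"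

definition diag :: "real^'n \<Rightarrow> real^'n^'n" where
  "diag v = (\<chi> i j. if i = j then v $ i else 0)"

text \<open>
  The block matrix with rows \<open>[B, v]\<close> and \<open>[v\<^sup>T, s]\<close>.  The index type \<open>'n option\<close>
  has one element more than \<open>'n\<close>; \<open>None\<close> is the index of the last row and column.
\<close>

definition bordered :: "real^'n^'n \<Rightarrow> real^'n \<Rightarrow> real \<Rightarrow> real^('n option)^('n option)" where
  "bordered B v s = (\<chi> i j.
     case i of
       Some k \<Rightarrow> (case j of Some l \<Rightarrow> B $ k $ l | None \<Rightarrow> v $ k)
     | None \<Rightarrow> (case j of Some l \<Rightarrow> v $ l | None \<Rightarrow> s))"

definition affine_fun_on :: "'a::real_vector set \<Rightarrow> ('a \<Rightarrow> 'b::real_vector) \<Rightarrow> bool" where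
  "affine_fun_on X f \<longleftrightarrow> (\<exists>L d. linear L \<and> (\<forall>x\<in>X. f x = L x + d))"

definition quadratic_on :: "(real^'d) set \<Rightarrow> (real^'d \<Rightarrow> real) \<Rightarrow> bool" where
  "quadratic_on X f \<longleftrightarrow>
     (\<exists>H g d. sym_mat H \<and> (\<forall>x\<in>X. f x = x \<bullet> (H *v x) + g \<bullet> x + d))"

definition uncertainty_set :: "real^'k^'j \<Rightarrow> real^'j \<Rightarrow> (real^'k) set" where
  "uncertainty_set S t = {\<xi>. 0 \<le> \<xi> \<and> S *v \<xi> = t}"

text \<open>
  The optimal values are extended reals, so that the infimum of an infeasible problem
  is \<open>\<infinity>\<close>.
\<close>

definition Z_val ::
  "(real^'d \<Rightarrow> real^'k^'m) \<Rightarrow> (real^'d \<Rightarrow> real^'k) \<Rightarrow> (real^'d \<Rightarrow> real) \<Rightarrow>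
   real^'k^'j \<Rightarrow> real^'j \<Rightarrow> real^'d \<Rightarrow> ereal" where
  "Z_val A b c S t x =
     (SUP \<xi>\<in>uncertainty_set S t. ereal ((norm (A x *v \<xi>))\<^sup>2 + b x \<bullet> \<xi> + c x))"

definition conic_matrix ::
  "real^'k^'m \<Rightarrow> real^'k \<Rightarrow> real^'k^'j \<Rightarrow> real^'k^'k \<Rightarrow> real^'k \<Rightarrow>
   real \<Rightarrow> real \<Rightarrow> real^'j \<Rightarrow> real^'j \<Rightarrow> real^('k option)^('k option)" where
  "conic_matrix Ax bx S Q q \<tau> lam \<psi> \<phi> =
     bordered
       (lam *\<^sub>R (transpose Q ** Q) + transpose S ** diag \<phi> ** S - transpose Ax ** Ax)
       ((1/2) *\<^sub>R (transpose S *v \<psi> - bx - (2 * lam) *\<^sub>R ((transpose Q ** Q) *v q)))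
       \<tau>"

text \<open>The first argument is the cone that the block matrix is constrained to.\<close>

definition conic_val ::
  "(real^('k option)^('k option)) set \<Rightarrow>
   (real^'d \<Rightarrow> real^'k^'m) \<Rightarrow> (real^'d \<Rightarrow> real^'k) \<Rightarrow> (real^'d \<Rightarrow> real) \<Rightarrow>
   real^'k^'j \<Rightarrow> real^'j \<Rightarrow> real^'k^'k \<Rightarrow> real^'k \<Rightarrow> real \<Rightarrow> real^'d \<Rightarrow> ereal" where
  "conic_val \<K> A b c S t Q q r x =
     Inf {ereal (c x + t \<bullet> \<psi> + (t * t) \<bullet> \<phi> + lam * r\<^sup>2 - lam * (norm (Q *v q))\<^sup>2 + \<tau>)
          | \<tau> lam \<psi> \<phi>. 0 \<le> lam \<and> conic_matrix (A x) (b x) S Q q \<tau> lam \<psi> \<phi> \<in> \<K>}"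

definition Z_cop ::
  "(real^'d \<Rightarrow> real^'k^'m) \<Rightarrow> (real^'d \<Rightarrow> real^'k) \<Rightarrow> (real^'d \<Rightarrow> real) \<Rightarrow>
   real^'k^'j \<Rightarrow> real^'j \<Rightarrow> real^'k^'k \<Rightarrow> real^'k \<Rightarrow> real \<Rightarrow> real^'d \<Rightarrow> ereal" where
  "Z_cop = conic_val copositive_cone"

definition Z_C0 ::
  "(real^'d \<Rightarrow> real^'k^'m) \<Rightarrow> (real^'d \<Rightarrow> real^'k) \<Rightarrow> (real^'d \<Rightarrow> real) \<Rightarrow>
   real^'k^'j \<Rightarrow> real^'j \<Rightarrow> real^'k^'k \<Rightarrow> real^'k \<Rightarrow> real \<Rightarrow> real^'d \<Rightarrow> ereal" where
  "Z_C0 = conic_val C0_cone"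

definition S_lemma_matrix ::
  "real^'k^'m \<Rightarrow> real^'k \<Rightarrow> real^'k^'j \<Rightarrow> real^'k^'k \<Rightarrow> real^'k \<Rightarrow>
   real \<Rightarrow> real \<Rightarrow> real^'j \<Rightarrow> real^'k \<Rightarrow> real^('k option)^('k option)" where
  "S_lemma_matrix Ax bx S Q q \<kappa> \<rho> \<theta> \<eta> =
     bordered
       (\<rho> *\<^sub>R (transpose Q ** Q) - transpose Ax ** Ax)
       ((1/2) *\<^sub>R (transpose S *v \<theta> - bx - \<eta> - (2 * \<rho>) *\<^sub>R ((transpose Q ** Q) *v q)))
       \<kappa>"

definition Z_S_lemma ::
  "(real^'d \<Rightarrow> real^'k^'m) \<Rightarrow> (real^'d \<Rightarrow> real^'k) \<Rightarrow> (real^'d \<Rightarrow> real) \<Rightarrow>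
   real^'k^'j \<Rightarrow> real^'j \<Rightarrow> real^'k^'k \<Rightarrow> real^'k \<Rightarrow> real \<Rightarrow> real^'d \<Rightarrow> ereal" where
  "Z_S_lemma A b c S t Q q r x =
     Inf {ereal (c x + t \<bullet> \<theta> + \<rho> * r\<^sup>2 - \<rho> * (norm (Q *v q))\<^sup>2 + \<kappa>)
          | \<kappa> \<rho> \<theta> \<eta>. 0 \<le> \<rho> \<and> 0 \<le> \<eta> \<and>
              S_lemma_matrix (A x) (b x) S Q q \<kappa> \<rho> \<theta> \<eta> \<in> psd_cone}"

end

theory Submission
  imports Defs
begin

text \<open>
  Evaluating the quadratic form of the block matrix at \<open>(\<xi>, 1)\<close> with \<open>\<xi> \<in> \<Xi>\<close> gives
  weak duality.  For the converse, given a real \<open>y > Z(x)\<close>, take \<open>\<lambda> = 0\<close>, \<open>\<phi> = \<rho> 1\<close>,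
  \<open>\<psi> = -2 \<rho> t\<close> and \<open>\<tau> = y - c(x) + \<rho> |t|\<^sup>2\<close>: the objective equals \<open>y\<close>, and the quadratic form is
  the quadratic penalty \<open>\<rho> |S \<xi> - s t|\<^sup>2\<close> added to the homogenization of \<open>y\<close> minus the
  worst-case objective.  The latter is positive on the zero set of the penalty, because
  \<open>\<Xi>\<close> has no nonzero recession direction, so compactness of the nonnegative part of the
  sphere makes the form copositive for large \<open>\<rho>\<close>.  For the last inequality, an \<open>S\<close>-lemma solution
  yields a \<open>C\<^sup>0\<close> solution with \<open>\<phi> = 0\<close>, where \<open>\<eta>\<close> goes into the nonnegative summand.
\<close>

section \<open>Quadratic forms of bordered matrices and the two cones\<close>

definition snoc_vec :: "real^'k \<Rightarrow> real \<Rightarrow> real^('k option)" where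
  "snoc_vec \<xi> s = (\<chi> i. case i of Some k \<Rightarrow> \<xi> $ k | None \<Rightarrow> s)"

lemma snoc_vec_cases:
  obtains \<xi> s where "z = snoc_vec \<xi> s"
proof
  show "z = snoc_vec (\<chi> k. z $ Some k) (z $ None)"
    by (simp add: snoc_vec_def vec_eq_iff split: option.split)
qed

lemma snoc_vec_nonneg_iff: "0 \<le> snoc_vec \<xi> s \<longleftrightarrow> 0 \<le> \<xi> \<and> 0 \<le> s"
  by (simp add: snoc_vec_def less_eq_vec_def split: option.split) blast

lemma sum_UNIV_option:
  fixes f :: "'k::finite option \<Rightarrow> 'a::comm_monoid_add"
  shows "(\<Sum>i\<in>UNIV. f i) = f None + (\<Sum>k\<in>UNIV. f (Some k))"
  by (simp add: UNIV_option_conv sum.reindex)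

lemma inner_bordered_snoc_vec:
  "snoc_vec \<xi> s \<bullet> (bordered B v \<sigma> *v snoc_vec \<xi> s) =
     \<xi> \<bullet> (B *v \<xi>) + 2 * s * (v \<bullet> \<xi>) + \<sigma> * s\<^sup>2"
  by (simp add: snoc_vec_def bordered_def inner_vec_def matrix_vector_mult_def
      sum_UNIV_option sum.distrib sum_distrib_left algebra_simps power2_eq_square)

lemma sym_mat_bordered: "sym_mat B \<Longrightarrow> sym_mat (bordered B v \<sigma>)"
  by (simp add: sym_mat_def bordered_def transpose_def vec_eq_iff split: option.split)

lemma bordered_add:
  "bordered B v s + bordered B' v' s' = bordered (B + B') (v + v') (s + s')"
  by (simp add: bordered_def vec_eq_iff split: option.split)

text \<open>The border is symmetric by construction, so symmetry of \<open>B\<close> settles the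
  symmetry clause. Every option-indexed vector is a \<open>snoc_vec\<close>, and its sign condition
  splits along the two blocks.\<close>

lemma bordered_mem_copositive_cone_iff:
  assumes "sym_mat B"
  shows "bordered B v \<sigma> \<in> copositive_cone \<longleftrightarrow>
    (\<forall>\<xi> s. 0 \<le> \<xi> \<longrightarrow> 0 \<le> s \<longrightarrow> 0 \<le> \<xi> \<bullet> (B *v \<xi>) + 2 * s * (v \<bullet> \<xi>) + \<sigma> * s\<^sup>2)"
  unfolding copositive_cone_def mem_Collect_eq inner_bordered_snoc_vec [symmetric]
  using sym_mat_bordered [OF assms] by (metis snoc_vec_cases snoc_vec_nonneg_iff)

text \<open>At \<open>z\<close> in the nonnegative orthant the form of \<open>N2\<close> is a sum of
  products of nonnegative numbers, and the form of \<open>N1\<close> is nonnegative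
  everywhere.\<close>

lemma C0_cone_subset_copositive_cone: "C0_cone \<subseteq> copositive_cone"
proof
  fix N :: "real^'n^'n" assume "N \<in> C0_cone"
  then obtain N1 N2 where N: "N = N1 + N2" "N1 \<in> psd_cone" "sym_mat N2" "0 \<le> N2"
    unfolding C0_cone_def by auto
  have "sym_mat N"
    using N unfolding sym_mat_def psd_cone_def by (simp add: transpose_def vec_eq_iff)
  moreover have "0 \<le> z \<bullet> (N *v z)" if "0 \<le> z" for z
  proof -
    have "0 \<le> z \<bullet> (N2 *v z)"
      using N(4) that unfolding inner_vec_def matrix_vector_mult_def less_eq_vec_def
      by (auto intro!: sum_nonneg mult_nonneg_nonneg)
    then show ?thesis
      using N(1,2) by (simp add: psd_cone_def matrix_vector_mult_add_rdistrib inner_add_right)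
  qed
  ultimately show "N \<in> copositive_cone"
    unfolding copositive_cone_def by simp
qed

section \<open>The copositivity constraint as a scalar inequality\<close>

lemma inner_transpose_mult_vec:
  fixes M :: "real^'k^'j"
  shows "(transpose M *v w) \<bullet> \<xi> = w \<bullet> (M *v \<xi>)"
  by (simp add: dot_lmul_matrix [symmetric])

lemma inner_gram_mult_vec:
  fixes M :: "real^'k^'j"
  shows "\<xi> \<bullet> ((transpose M ** M) *v \<zeta>) = (M *v \<xi>) \<bullet> (M *v \<zeta>)"
  by (metis inner_commute inner_transpose_mult_vec matrix_vector_mul_assoc)

lemma diag_mult_vec: "diag \<phi> *v w = \<phi> * w"
  by (simp add: diag_def matrix_vector_mult_def vec_eq_iff if_distrib [of "\<lambda>a. a * _"] cong: if_cong)

lemma sym_mat_conic_block: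
  fixes Ax :: "real^'k^'m" and S :: "real^'k^'j" and Q :: "real^'k^'k"
  shows "sym_mat (lam *\<^sub>R (transpose Q ** Q) + transpose S ** diag \<phi> ** S - transpose Ax ** Ax)"
proof -
  have lin: "transpose (a *\<^sub>R M + N - P) = a *\<^sub>R transpose M + transpose N - transpose P"
    for a and M N P :: "real^'k^'k"
    by (simp add: transpose_def vec_eq_iff)
  have "transpose (diag \<phi>) = diag \<phi>"
    by (auto simp: transpose_def diag_def vec_eq_iff)
  then show ?thesis
    unfolding sym_mat_def lin by (simp add: matrix_transpose_mul matrix_mul_assoc)
qed

text \<open>Serves both halves of the duality: weak duality reads the inequality at
  \<open>s = 1\<close>, and strong duality establishes it for all \<open>s\<close> at least
  0.\<close>

lemma conic_matrix_mem_copositive_cone_iff: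
  fixes Ax :: "real^'k^'m" and S :: "real^'k^'j"
  shows "conic_matrix Ax bx S Q q \<tau> lam \<psi> \<phi> \<in> copositive_cone \<longleftrightarrow>
    (\<forall>\<xi> s. 0 \<le> \<xi> \<longrightarrow> 0 \<le> s \<longrightarrow>
      0 \<le> lam * (norm (Q *v \<xi>))\<^sup>2 + (S *v \<xi>) \<bullet> (\<phi> * (S *v \<xi>)) - (norm (Ax *v \<xi>))\<^sup>2
        + s * (\<psi> \<bullet> (S *v \<xi>) - bx \<bullet> \<xi> - 2 * lam * ((Q *v q) \<bullet> (Q *v \<xi>))) + \<tau> * s\<^sup>2)"
proof -
  have "\<xi> \<bullet> ((lam *\<^sub>R (transpose Q ** Q) + transpose S ** diag \<phi> ** S - transpose Ax ** Ax) *v \<xi>)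
    = lam * (norm (Q *v \<xi>))\<^sup>2 + (S *v \<xi>) \<bullet> (\<phi> * (S *v \<xi>)) - (norm (Ax *v \<xi>))\<^sup>2" for \<xi>
  proof -
    have "\<xi> \<bullet> ((transpose S ** diag \<phi> ** S) *v \<xi>) = (S *v \<xi>) \<bullet> (\<phi> * (S *v \<xi>))"
      by (metis diag_mult_vec inner_commute inner_transpose_mult_vec matrix_vector_mul_assoc)
    then show ?thesis
      by (simp only: matrix_vector_mult_diff_rdistrib matrix_vector_mult_add_rdistrib
          scaleR_matrix_vector_assoc [symmetric] inner_diff_right inner_add_right
          inner_scaleR_right inner_gram_mult_vec power2_norm_eq_inner)
  qed
  moreover have "2 * s * (((1/2) *\<^sub>R (transpose S *v \<psi> - bx - (2 * lam) *\<^sub>R ((transpose Q ** Q) *v q))) \<bullet> \<xi>)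
    = s * (\<psi> \<bullet> (S *v \<xi>) - bx \<bullet> \<xi> - 2 * lam * ((Q *v q) \<bullet> (Q *v \<xi>)))" for s \<xi>
  proof -
    have "((transpose Q ** Q) *v q) \<bullet> \<xi> = (Q *v q) \<bullet> (Q *v \<xi>)"
      by (metis inner_commute inner_gram_mult_vec)
    then show ?thesis
      by (simp only: inner_scaleR_left inner_diff_left inner_transpose_mult_vec)
  qed
  ultimately show ?thesis
    unfolding conic_matrix_def bordered_mem_copositive_cone_iff [OF sym_mat_conic_block] by (simp only:)
qed

section \<open>Exact penalties and recession directions\<close>

lemma exact_penalty_on_compact:
  fixes f g :: "'a::topological_space \<Rightarrow> real"
  assumes "compact K" and f: "continuous_on K f" and g: "continuous_on K g"
    and g0: "\<And>z. z \<in> K \<Longrightarrow> 0 \<le> g z"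
    and pos: "\<And>z. z \<in> K \<Longrightarrow> g z = 0 \<Longrightarrow> 0 < f z"
  obtains \<rho> where "0 \<le> \<rho>" and "\<And>z. z \<in> K \<Longrightarrow> 0 \<le> f z + \<rho> * g z"
proof -
  \<comment> \<open>A penalty matters only where \<open>f\<close> is nonpositive. There
    \<open>g\<close> is positive, so the weight that a point requires, \<open>- f z / g z\<close>,
    is continuous on a compact set and hence bounded.\<close>
  let ?N = "{z \<in> K. f z \<le> 0}"
  have gpos: "0 < g z" if "z \<in> ?N" for z
    using g0 [of z] pos [of z] that by force
  have "compact ((\<lambda>z. - f z / g z) ` ?N)"
  proof (rule compact_continuous_image)
    show "continuous_on ?N (\<lambda>z. - f z / g z)"
      using gpos by (intro continuous_intros continuous_on_subset [OF f] continuous_on_subset [OF g]) force+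
    \<comment> \<open>A compact set need not be closed in a general topological space, so the
      sublevel set is exhibited as the trace on \<open>K\<close> of a closed set.\<close>
    obtain T where "closed T" "T \<inter> K = f -` {..0} \<inter> K"
      using continuous_on_closed_invariant [of K f] f closed_atMost by blast
    moreover have "?N = f -` {..0} \<inter> K" by auto
    ultimately show "compact ?N"
      using \<open>compact K\<close> by (metis closed_Int_compact)
  qed
  then have "bdd_above ((\<lambda>z. - f z / g z) ` ?N)"
    by (intro bounded_imp_bdd_above compact_imp_bounded)
  then obtain M where M: "\<And>z. z \<in> ?N \<Longrightarrow> - f z / g z \<le> M"
    unfolding bdd_above_def by blast
  \<comment> \<open>If \<open>?N\<close> is empty, \<open>M\<close> is arbitrary and may be
    negative; the truncation at 0 covers this case and keeps the penalty term nonnegative where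
    \<open>f\<close> is positive.\<close>
  have "0 \<le> f z + max 0 M * g z" if "z \<in> K" for z
  proof (cases "f z \<le> 0")
    case True
    then have "- f z \<le> M * g z"
      using M [of z] gpos [of z] that by (simp only: mem_Collect_eq pos_divide_le_eq simp_thms)
    moreover have "M * g z \<le> max 0 M * g z"
      using g0 [OF that] by (intro mult_right_mono) auto
    ultimately show ?thesis by linarith
  next
    case False
    then show ?thesis
      using g0 [OF that] by (simp add: add_nonneg_nonneg)
  qed
  then show thesis
    using that [of "max 0 M"] by simp
qed

text \<open>From a feasible point the whole ray in direction \<open>d\<close> stays feasible, which
  boundedness forbids unless \<open>d\<close> vanishes.\<close>

lemma uncertainty_set_recession_trivial:
  assumes ne: "uncertainty_set S t \<noteq> {}" and bdd: "bounded (uncertainty_set S t)"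
    and d: "0 \<le> d" "S *v d = 0"
  shows "d = 0"
proof (rule ccontr)
  assume "d \<noteq> 0"
  obtain \<xi> where \<xi>: "0 \<le> \<xi>" "S *v \<xi> = t"
    using ne unfolding uncertainty_set_def by auto
  obtain B where B: "\<And>\<zeta>. \<zeta> \<in> uncertainty_set S t \<Longrightarrow> norm \<zeta> \<le> B"
    using bdd unfolding bounded_iff by auto
  \<comment> \<open>This makes the step \<open>a *\<^sub>R d\<close> so long that, even after losing
    \<open>norm \<xi>\<close> in the triangle inequality, the new point lies beyond the bound
    \<open>B\<close>.\<close>
  define a where "a = (\<bar>B\<bar> + norm \<xi> + 1) / norm d"
  have "0 \<le> a" unfolding a_def by (simp add: add_nonneg_nonneg)
  then have "\<xi> + a *\<^sub>R d \<in> uncertainty_set S t"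
    using \<xi> d unfolding uncertainty_set_def
    by (simp add: matrix_vector_right_distrib matrix_vector_mult_scaleR less_eq_vec_def)
  then have "norm (\<xi> + a *\<^sub>R d) \<le> B" by (rule B)
  moreover have "norm (a *\<^sub>R d) = \<bar>B\<bar> + norm \<xi> + 1"
    using \<open>d \<noteq> 0\<close> \<open>0 \<le> a\<close> by (simp add: a_def)
  moreover have "norm (a *\<^sub>R d) \<le> norm (\<xi> + a *\<^sub>R d) + norm \<xi>"
    by (metis add_diff_cancel_left' norm_triangle_ineq4)
  ultimately show False by linarith
qed

section \<open>Weak and strong duality\<close>

lemma Z_val_le_Z_cop:
  fixes A :: "real^'d \<Rightarrow> real^'k^'m" and S :: "real^'k^'j"
  assumes ball: "uncertainty_set S t \<subseteq> {\<xi>. norm (Q *v (\<xi> - q)) \<le> r}"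
  shows "Z_val A b c S t x \<le> Z_cop A b c S t Q q r x"
  unfolding Z_val_def Z_cop_def conic_val_def
proof (intro SUP_least Inf_greatest, clarify)
  fix \<xi> \<tau> lam \<psi> \<phi>
  assume \<xi>: "\<xi> \<in> uncertainty_set S t" and lam: "0 \<le> (lam::real)"
    and cop: "conic_matrix (A x) (b x) S Q q \<tau> lam \<psi> \<phi> \<in> copositive_cone"
  have \<xi>0: "0 \<le> \<xi>" and S\<xi>: "S *v \<xi> = t"
    using \<xi> unfolding uncertainty_set_def by auto
  have "0 \<le> lam * (norm (Q *v \<xi>))\<^sup>2 + t \<bullet> (\<phi> * t) - (norm (A x *v \<xi>))\<^sup>2
        + (\<psi> \<bullet> t - b x \<bullet> \<xi> - 2 * lam * ((Q *v q) \<bullet> (Q *v \<xi>))) + \<tau>"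
    using cop [unfolded conic_matrix_mem_copositive_cone_iff, rule_format, OF \<xi>0, of 1] S\<xi> by simp
  moreover have "t \<bullet> (\<phi> * t) = (t * t) \<bullet> \<phi>"
    by (simp add: inner_vec_def algebra_simps)
  \<comment> \<open>The dual objective minus the primal value at \<open>\<xi>\<close> equals the
    form above plus \<open>lam\<close> times the slack between \<open>r\<^sup>2\<close> and this
    squared distance; the ball condition makes that slack nonnegative.\<close>
  moreover have "lam * (norm (Q *v (\<xi> - q)))\<^sup>2 =
      lam * (norm (Q *v \<xi>))\<^sup>2 - 2 * lam * ((Q *v q) \<bullet> (Q *v \<xi>)) + lam * (norm (Q *v q))\<^sup>2"
    by (simp add: matrix_vector_mult_diff_distrib power2_norm_eq_inner inner_diff inner_commute algebra_simps)
  moreover have "lam * (norm (Q *v (\<xi> - q)))\<^sup>2 \<le> lam * r\<^sup>2"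
    using ball \<xi> lam by (intro mult_left_mono power_mono) auto
  ultimately show "ereal ((norm (A x *v \<xi>))\<^sup>2 + b x \<bullet> \<xi> + c x)
      \<le> ereal (c x + t \<bullet> \<psi> + (t * t) \<bullet> \<phi> + lam * r\<^sup>2 - lam * (norm (Q *v q))\<^sup>2 + \<tau>)"
    unfolding inner_commute [of t \<psi>] ereal_less_eq by linarith
qed

lemma Z_cop_le_Z_val:
  fixes A :: "real^'d \<Rightarrow> real^'k^'m" and S :: "real^'k^'j"
  assumes ne: "uncertainty_set S t \<noteq> {}" and bdd: "bounded (uncertainty_set S t)"
  shows "Z_cop A b c S t Q q r x \<le> Z_val A b c S t x"
proof (rule dense_ge)
  \<comment> \<open>The strict gap above the supremum yields the strict positivity that the penalty
    argument requires, and no dual optimum has to be attained.\<close>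
  fix y' assume y': "Z_val A b c S t x < y'"
  show "Z_cop A b c S t Q q r x \<le> y'"
  proof (cases y')
    case (real y)
    have below: "(norm (A x *v \<xi>))\<^sup>2 + b x \<bullet> \<xi> + c x < y" if "\<xi> \<in> uncertainty_set S t" for \<xi>
      using le_less_trans [OF SUP_upper [OF that] y' [unfolded Z_val_def]] real by simp
    \<comment> \<open>At \<open>(s *\<^sub>R \<zeta>, s)\<close> the value of \<open>f\<close> is
      \<open>s\<^sup>2\<close> times the gap between \<open>y\<close> and the objective at
      \<open>\<zeta>\<close>. Both \<open>f\<close> and \<open>g\<close> are homogeneous of degree
      2, so unit vectors suffice.\<close>
    define f where "f = (\<lambda>z. (y - c x) * (snd z)\<^sup>2 - (norm (A x *v fst z))\<^sup>2 - snd z * (b x \<bullet> fst z))"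
    define g where "g = (\<lambda>z. (norm (S *v fst z - snd z *\<^sub>R t))\<^sup>2)"
    let ?K = "sphere 0 1 \<inter> ({\<xi>. 0 \<le> \<xi>} \<times> {0..}) :: ((real^'k) \<times> real) set"
    have cont: "continuous_on ?K f" "continuous_on ?K g"
      unfolding f_def g_def
      by (intro continuous_intros bounded_linear.continuous_on [OF matrix_vector_mul_bounded_linear])+
    have fpos: "0 < f z" if "z \<in> ?K" "g z = 0" for z
    proof -
      obtain \<xi> s where z: "z = (\<xi>, s)" by (cases z)
      have nn: "0 \<le> \<xi>" "0 \<le> s" and S\<xi>: "S *v \<xi> = s *\<^sub>R t" and "z \<noteq> 0"
        using that z by (auto simp: g_def)
      \<comment> \<open>With \<open>s = 0\<close> the vector \<open>\<xi>\<close> would be a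
        nonnegative kernel vector of \<open>S\<close>, hence 0, against \<open>z\<close> having norm
        1.\<close>
      have "s \<noteq> 0"
        using uncertainty_set_recession_trivial [OF ne bdd, of \<xi>] nn S\<xi> \<open>z \<noteq> 0\<close> z by (auto simp: zero_prod_def)
      then have "0 < s" using nn by simp
      define \<zeta> where "\<zeta> = inverse s *\<^sub>R \<xi>"
      have \<xi>: "\<xi> = s *\<^sub>R \<zeta>" using \<open>0 < s\<close> by (simp add: \<zeta>_def)
      have "\<zeta> \<in> uncertainty_set S t"
        using nn S\<xi> \<open>0 < s\<close> unfolding uncertainty_set_def \<zeta>_def
        by (simp add: matrix_vector_mult_scaleR less_eq_vec_def)
      from below [OF this] have "0 < s\<^sup>2 * (y - ((norm (A x *v \<zeta>))\<^sup>2 + b x \<bullet> \<zeta> + c x))"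
        using \<open>0 < s\<close> by simp
      also have "\<dots> = f z"
        unfolding f_def z \<xi>
        by (simp add: matrix_vector_mult_scaleR power_mult_distrib algebra_simps power2_eq_square)
      finally show ?thesis .
    qed
    have "closed ({\<xi>. 0 \<le> \<xi>} :: (real^'k) set)"
      by (simp add: less_eq_vec_def closed_positive_orthant)
    then have "compact ?K"
      by (intro compact_Int_closed closed_Times) auto
    then obtain \<rho> where "0 \<le> \<rho>" and \<rho>: "\<And>z. z \<in> ?K \<Longrightarrow> 0 \<le> f z + \<rho> * g z"
      using exact_penalty_on_compact [OF _ cont] fpos by (metis g_def zero_le_power2)
    \<comment> \<open>Extends the bound from the sphere to the whole cone by scaling; the origin
      cannot be normalized and is treated separately.\<close>
    have pen: "0 \<le> f (\<xi>, s) + \<rho> * g (\<xi>, s)" if nn: "0 \<le> \<xi>" "0 \<le> s" for \<xi> s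
    proof (cases "(\<xi>, s) = 0")
      case True
      then show ?thesis by (simp add: f_def g_def zero_prod_def)
    next
      case False
      define a where "a = norm (\<xi>, s)"
      have "0 < a" using False by (simp add: a_def)
      define \<zeta> u where "\<zeta> = inverse a *\<^sub>R \<xi>" and "u = inverse a * s"
      have eq: "\<xi> = a *\<^sub>R \<zeta>" "s = a * u"
        using \<open>0 < a\<close> by (simp_all add: \<zeta>_def u_def)
      have "norm (\<zeta>, u) = norm (inverse a *\<^sub>R (\<xi>, s))" by (simp add: \<zeta>_def u_def)
      also have "\<dots> = 1" using \<open>0 < a\<close> by (simp only: norm_scaleR a_def [symmetric]) simp
      finally have "(\<zeta>, u) \<in> ?K"
        using nn \<open>0 < a\<close> by (simp add: \<zeta>_def u_def less_eq_vec_def)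
      then have "0 \<le> a\<^sup>2 * (f (\<zeta>, u) + \<rho> * g (\<zeta>, u))" by (intro mult_nonneg_nonneg \<rho>) auto
      also have "\<dots> = f (\<xi>, s) + \<rho> * g (\<xi>, s)"
      proof -
        have "S *v \<xi> - s *\<^sub>R t = a *\<^sub>R (S *v \<zeta> - u *\<^sub>R t)"
          by (simp add: eq matrix_vector_mult_scaleR scaleR_diff_right)
        then have "g (\<xi>, s) = a\<^sup>2 * g (\<zeta>, u)"
          by (simp add: g_def power_mult_distrib)
        moreover have "f (\<xi>, s) = a\<^sup>2 * f (\<zeta>, u)"
          unfolding f_def by (simp add: eq matrix_vector_mult_scaleR power_mult_distrib algebra_simps power2_eq_square)
        ultimately show ?thesis by (simp add: algebra_simps)
      qed
      finally show ?thesis .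
    qed
    \<comment> \<open>The multipliers are read off the expanded penalty: its square in
      \<open>S *v \<xi>\<close> goes to \<open>\<phi>\<close>, its cross term to the linear
      multiplier \<open>(-2 * \<rho>) *\<^sub>R t\<close>, and its \<open>s\<^sup>2\<close> term to
      \<open>\<tau>\<close>.\<close>
    define \<phi> :: "real^'j" where "\<phi> = (\<chi> i. \<rho>)"
    have \<phi>: "\<phi> * w = \<rho> *\<^sub>R w" for w
      by (simp add: \<phi>_def vec_eq_iff)
    have sq: "(t * t) \<bullet> \<phi> = \<rho> * (t \<bullet> t)"
      by (simp add: \<phi>_def inner_vec_def sum_distrib_left mult.commute)
    define \<tau> where "\<tau> = y - c x + \<rho> * (t \<bullet> t)"
    have "conic_matrix (A x) (b x) S Q q \<tau> 0 ((-2 * \<rho>) *\<^sub>R t) \<phi> \<in> copositive_cone"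
      unfolding conic_matrix_mem_copositive_cone_iff
    proof (intro allI impI)
      fix \<xi> :: "real^'k" and s :: real assume nn: "0 \<le> \<xi>" "0 \<le> s"
      have "\<rho> * g (\<xi>, s) = \<rho> * ((S *v \<xi>) \<bullet> (S *v \<xi>)) - 2 * \<rho> * s * (t \<bullet> (S *v \<xi>)) + \<rho> * s\<^sup>2 * (t \<bullet> t)"
        unfolding g_def power2_norm_eq_inner
        by (simp add: inner_diff inner_commute power2_eq_square algebra_simps)
      then show "0 \<le> 0 * (norm (Q *v \<xi>))\<^sup>2 + (S *v \<xi>) \<bullet> (\<phi> * (S *v \<xi>)) - (norm (A x *v \<xi>))\<^sup>2
        + s * (((-2 * \<rho>) *\<^sub>R t) \<bullet> (S *v \<xi>) - b x \<bullet> \<xi> - 2 * 0 * ((Q *v q) \<bullet> (Q *v \<xi>))) + \<tau> * s\<^sup>2"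
        using pen [OF nn] by (simp add: f_def \<phi> \<tau>_def algebra_simps)
    qed
    then have "Z_cop A b c S t Q q r x \<le>
      ereal (c x + t \<bullet> ((-2 * \<rho>) *\<^sub>R t) + (t * t) \<bullet> \<phi> + 0 * r\<^sup>2 - 0 * (norm (Q *v q))\<^sup>2 + \<tau>)"
      unfolding Z_cop_def conic_val_def by (intro Inf_lower) blast
    \<comment> \<open>The multiples of \<open>t \<bullet> t\<close> have coefficients
      \<open>-2 * \<rho>\<close>, \<open>\<rho>\<close> and \<open>\<rho>\<close>, and
      cancel.\<close>
    also have "\<dots> = y'"
      by (simp add: real sq \<tau>_def)
    finally show ?thesis .
  \<comment> \<open>For infinite \<open>y'\<close> the bound is trivial, and minus infinity cannot
    lie strictly above anything.\<close>
  qed (use y' in auto)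
qed

section \<open>Comparison of the cones and of the S-lemma bound\<close>

lemma conic_val_antimono: "\<K> \<subseteq> \<L> \<Longrightarrow> conic_val \<L> A b c S t Q q r x \<le> conic_val \<K> A b c S t Q q r x"
  unfolding conic_val_def by (intro Inf_superset_mono) blast

lemma Z_C0_le_Z_S_lemma:
  fixes A :: "real^'d \<Rightarrow> real^'k^'m" and S :: "real^'k^'j"
  shows "Z_C0 A b c S t Q q r x \<le> Z_S_lemma A b c S t Q q r x"
  unfolding Z_S_lemma_def
proof (intro Inf_greatest, clarify)
  fix \<kappa> \<rho> :: real and \<theta> :: "real^'j" and \<eta> :: "real^'k"
  assume \<rho>: "0 \<le> \<rho>" and \<eta>: "0 \<le> \<eta>"
    and psd: "S_lemma_matrix (A x) (b x) S Q q \<kappa> \<rho> \<theta> \<eta> \<in> psd_cone"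
  \<comment> \<open>With the quadratic multiplier 0, the two block matrices differ only by the
    summand \<open>- \<eta> / 2\<close> in the border of the S-lemma matrix; adding
    \<open>?N\<close> cancels it.\<close>
  let ?N = "bordered 0 ((1/2) *\<^sub>R \<eta>) 0"
  have "diag (0 :: real^'j) = 0"
    by (simp add: diag_def vec_eq_iff)
  then have "conic_matrix (A x) (b x) S Q q \<kappa> \<rho> \<theta> 0 = S_lemma_matrix (A x) (b x) S Q q \<kappa> \<rho> \<theta> \<eta> + ?N"
    unfolding conic_matrix_def S_lemma_matrix_def bordered_add
    by (simp add: algebra_simps)
  moreover have "sym_mat ?N"
    by (intro sym_mat_bordered) (simp add: sym_mat_def transpose_def vec_eq_iff)
  moreover have "0 \<le> ?N"
    using \<eta> by (auto simp: bordered_def less_eq_vec_def split: option.split)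
  ultimately have "conic_matrix (A x) (b x) S Q q \<kappa> \<rho> \<theta> 0 \<in> C0_cone"
    using psd unfolding C0_cone_def by blast
  then have "Z_C0 A b c S t Q q r x \<le>
    ereal (c x + t \<bullet> \<theta> + (t * t) \<bullet> 0 + \<rho> * r\<^sup>2 - \<rho> * (norm (Q *v q))\<^sup>2 + \<kappa>)"
    unfolding Z_C0_def conic_val_def using \<rho> by (intro Inf_lower) blast
  then show "Z_C0 A b c S t Q q r x \<le>
    ereal (c x + t \<bullet> \<theta> + \<rho> * r\<^sup>2 - \<rho> * (norm (Q *v q))\<^sup>2 + \<kappa>)"
    by simp
qed

theorem proposition4:
  fixes X :: "(real^'d) set"
    and A :: "real^'d \<Rightarrow> real^'k^'m"
    and b :: "real^'d \<Rightarrow> real^'k"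
    and c :: "real^'d \<Rightarrow> real"
    and S :: "real^'k^'j"
    and t :: "real^'j"
    and Q :: "real^'k^'k"
    and q :: "real^'k"
    and r :: real
    and x :: "real^'d"
  assumes "polytope X"
    and "affine_fun_on X A"
    and "affine_fun_on X b"
    and "quadratic_on X c" and "convex_on X c"
    and "uncertainty_set S t \<noteq> {}"
    and "bounded (uncertainty_set S t)"
    and "pos_def Q"
    and "0 \<le> q"
    and "0 < r"
    and "uncertainty_set S t \<subseteq> {\<xi>. norm (Q *v (\<xi> - q)) \<le> r}"
    and "x \<in> X"
  shows "Z_val A b c S t x = Z_cop A b c S t Q q r x
    \<and> Z_cop A b c S t Q q r x \<le> Z_C0 A b c S t Q q r x
    \<and> Z_C0 A b c S t Q q r x \<le> Z_S_lemma A b c S t Q q r x"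
proof (intro conjI)
  show "Z_val A b c S t x = Z_cop A b c S t Q q r x"
    by (rule antisym [OF Z_val_le_Z_cop [OF assms(11)] Z_cop_le_Z_val [OF assms(6,7)]])
  show "Z_cop A b c S t Q q r x \<le> Z_C0 A b c S t Q q r x"
    unfolding Z_cop_def Z_C0_def by (rule conic_val_antimono [OF C0_cone_subset_copositive_cone])
  show "Z_C0 A b c S t Q q r x \<le> Z_S_lemma A b c S t Q q r x"
    by (rule Z_C0_le_Z_S_lemma)
qed

end
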